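(* Let $H$ be a nonzero finite-dimensional real Hilbert space, $\mathcal{V}$ a linear subspace of $H$, and $\Lambda:H\to\mathbb{R}^m$ a linear map with $\mathcal{V}\cap\ker(\Lambda)=\{0\}$. Let $\varepsilon>0$, $\eta\ge0$, and consider the approximability set $\mathcal{K}=\{f\in H:\mathrm{dist}(f,\mathcal{V})\le\varepsilon\}$ and the uncertainty set $\mathcal{E}=\{e\in\mathbb{R}^m:\|e\|\le\eta\}$. Define $\tau_\flat:=d_\flat/(c_\flat+d_\flat)$, where $c_\flat,d_\flat\ge0$ are solutions to $$\underset{c,d\ge0}{\mathrm{minimize}}\ c\,\varepsilon^2+d\,\eta^2\qquad\text{subject to}\quad cP_{\mathcal{V}^\perp}+d\,\Lambda^*\Lambda\succeq\mathrm{Id}.$$ Then the regularization map $\Delta_{\tau_\flat}$ is a globally optimal recovery map over $\mathcal{K}$ and $\mathcal{E}$, i.e., $$\mathrm{gwce}(\Delta_{\tau_\flat})=\inf_{\Delta:\mathbb{R}^m\to H}\mathrm{gwce}(\Delta),$$ the infimum being over all (not necessarily linear) maps $\Delta:\mathbb{R}^m\to H$.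
   Context: $\mathbb{R}^m$ carries the Euclidean norm. $P_{\mathcal{V}^\perp}$ is the orthogonal projector onto the orthogonal complement of $\mathcal{V}$, so $\mathrm{dist}(f,\mathcal{V})=\|P_{\mathcal{V}^\perp}f\|$. $\Lambda^*$ is the adjoint of $\Lambda$. $T\succeq T'$ means that $T-T'$ is positive semidefinite. The global worst-case error of a map $\Delta:\mathbb{R}^m\to H$ is $$\mathrm{gwce}(\Delta)=\sup\{\|f-\Delta(\Lambda f+e)\|:\ f\in H,\ \|P_{\mathcal{V}^\perp}f\|\le\varepsilon,\ e\in\mathbb{R}^m,\ \|e\|\le\eta\}.$$ The regularization map is $\Delta_\tau:y\in\mathbb{R}^m\mapsto\mathrm{argmin}_{f\in H}\ (1-\tau)\|P_{\mathcal{V}^\perp}f\|^2+\tau\|\Lambda f-y\|^2$; for $\tau=\tau_\flat$ the minimizer is unique because the constraint makes $(1-\tau_\flat)P_{\mathcal{V}^\perp}+\tau_\flat\Lambda^*\Lambda$ positive definite. *)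

theory Defs
  imports "HOL-Analysis.Analysis"
begin

definition ortho_proj :: "'a::euclidean_space set \<Rightarrow> 'a \<Rightarrow> 'a" where
  "ortho_proj W x = (THE y. y \<in> W \<and> x - y \<in> W\<^sup>\<bottom>)"

abbreviation proj_perp :: "'a::euclidean_space set \<Rightarrow> 'a \<Rightarrow> 'a" where
  "proj_perp V \<equiv> ortho_proj (V\<^sup>\<bottom>)"

definition pos_semidef :: "('a::euclidean_space \<Rightarrow> 'a) \<Rightarrow> bool" where
  "pos_semidef T \<longleftrightarrow> linear T \<and> adjoint T = T \<and> (\<forall>x. 0 \<le> T x \<bullet> x)"

definition loewner_ge :: "('a::euclidean_space \<Rightarrow> 'a) \<Rightarrow> ('a \<Rightarrow> 'a) \<Rightarrow> bool" where
  "loewner_ge T T' \<longleftrightarrow> pos_semidef (\<lambda>x. T x - T' x)"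

definition approximability_set :: "'a::euclidean_space set \<Rightarrow> real \<Rightarrow> 'a set" where
  "approximability_set V \<epsilon> = {f. infdist f V \<le> \<epsilon>}"

definition uncertainty_set :: "real \<Rightarrow> (real ^ 'm) set" where
  "uncertainty_set \<eta> = {e. norm e \<le> \<eta>}"

(* The supremum is taken in the extended reals: it may be infinite for an arbitrary \<Delta>. *)
definition gwce ::
  "('a::euclidean_space \<Rightarrow> real ^ 'm) \<Rightarrow> 'a set \<Rightarrow> (real ^ 'm) set \<Rightarrow> (real ^ 'm \<Rightarrow> 'a) \<Rightarrow> ereal" where
  "gwce \<Lambda> K E \<Delta> = (SUP (f, e) \<in> K \<times> E. ereal (norm (f - \<Delta> (\<Lambda> f + e))))"

definition reg_objective ::
  "'a::euclidean_space set \<Rightarrow> ('a \<Rightarrow> real ^ 'm) \<Rightarrow> real \<Rightarrow> real ^ 'm \<Rightarrow> 'a \<Rightarrow> real" where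
  "reg_objective V \<Lambda> \<tau> y f =
     (1 - \<tau>) * (norm (proj_perp V f))\<^sup>2 + \<tau> * (norm (\<Lambda> f - y))\<^sup>2"

definition reg_map ::
  "'a::euclidean_space set \<Rightarrow> ('a \<Rightarrow> real ^ 'm) \<Rightarrow> real \<Rightarrow> real ^ 'm \<Rightarrow> 'a" where
  "reg_map V \<Lambda> \<tau> y = (ARG_MIN (reg_objective V \<Lambda> \<tau> y) f. True)"

definition feasible ::
  "'a::euclidean_space set \<Rightarrow> ('a \<Rightarrow> real ^ 'm) \<Rightarrow> real \<times> real \<Rightarrow> bool" where
  "feasible V \<Lambda> = (\<lambda>(c, d). 0 \<le> c \<and> 0 \<le> d \<and>
     loewner_ge (\<lambda>f. c *\<^sub>R proj_perp V f + d *\<^sub>R adjoint \<Lambda> (\<Lambda> f)) id)"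

lemma ortho_proj_ex1:
  fixes W :: "'a::euclidean_space set"
  assumes "subspace W"
  shows "\<exists>!y. y \<in> W \<and> x - y \<in> W\<^sup>\<bottom>"
proof (rule ex_ex1I)
  obtain y z where "y \<in> span W" "\<And>w. w \<in> span W \<Longrightarrow> orthogonal z w" "x = y + z"
    using orthogonal_subspace_decomp_exists[of W x] by metis
  then show "\<exists>y. y \<in> W \<and> x - y \<in> W\<^sup>\<bottom>"
    using assms by (auto simp: orthogonal_comp_def orthogonal_commute span_base intro!: exI[of _ y] dest: span_eq_iff[THEN iffD2])
next
  fix y y' assume a: "y \<in> W \<and> x - y \<in> W\<^sup>\<bottom>" and b: "y' \<in> W \<and> x - y' \<in> W\<^sup>\<bottom>"
  then have "y - y' \<in> W" using assms by (simp add: subspace_diff)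
  with a b have "(y - y') \<bullet> (x - y') = 0" "(y - y') \<bullet> (x - y) = 0"
    by (auto simp: orthogonal_comp_def orthogonal_def)
  then have "(y - y') \<bullet> (y - y') = 0" by (simp add: inner_diff_right)
  then show "y = y'" by simp
qed

lemma proj_perp_unique:
  fixes V :: "'a::euclidean_space set"
  assumes "subspace V" "y \<in> V\<^sup>\<bottom>" "x - y \<in> V"
  shows "proj_perp V x = y"
  unfolding ortho_proj_def
  by (rule the1_equality[OF ortho_proj_ex1[OF subspace_orthogonal_comp]])
     (use assms orthogonal_comp_self[OF assms(1)] in auto)

lemma proj_perp_works:
  fixes V :: "'a::euclidean_space set"
  assumes "subspace V"
  shows "proj_perp V x \<in> V\<^sup>\<bottom>" "x - proj_perp V x \<in> V"
  using theI'[OF ortho_proj_ex1[OF subspace_orthogonal_comp[of V], of x]]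
    orthogonal_comp_self[OF assms]
  unfolding ortho_proj_def by auto

lemma infdist_eq_norm_proj_perp:
  fixes V :: "'a::euclidean_space set"
  assumes "subspace V"
  shows "infdist f V = norm (proj_perp V f)"
proof (rule antisym)
  let ?p = "proj_perp V f"
  note p = proj_perp_works[OF assms, of f]
  show "infdist f V \<le> norm ?p"
    using infdist_le[OF p(2), of f] by (simp add: dist_norm)
  have "norm ?p \<le> dist f v" if v: "v \<in> V" for v
  proof -
    have "(f - ?p) - v \<in> V" using p(2) v assms by (simp add: subspace_diff)
    then have "orthogonal ((f - ?p) - v) ?p"
      using p(1) by (auto simp: orthogonal_comp_def)
    then have "(norm (((f - ?p) - v) + ?p))\<^sup>2 = (norm ((f - ?p) - v))\<^sup>2 + (norm ?p)\<^sup>2"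
      by (rule norm_add_Pythagorean)
    then have "(norm ?p)\<^sup>2 \<le> (norm (f - v))\<^sup>2"
      by (simp add: algebra_simps)
    then show ?thesis by (simp add: dist_norm)
  qed
  then show "norm ?p \<le> infdist f V"
    using subspace_0[OF assms] by (auto simp: infdist_def intro!: cINF_greatest)
qed

lemma gwce_eq:
  fixes V :: "'a::euclidean_space set" and \<Lambda> :: "'a \<Rightarrow> real ^ 'm"
  assumes "subspace V"
  shows "gwce \<Lambda> (approximability_set V \<epsilon>) (uncertainty_set \<eta>) \<Delta> =
    Sup {ereal (norm (f - \<Delta> (\<Lambda> f + e))) | f e. norm (proj_perp V f) \<le> \<epsilon> \<and> norm e \<le> \<eta>}"
  unfolding gwce_def approximability_set_def uncertainty_set_def
    infdist_eq_norm_proj_perp[OF assms]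
  by (rule arg_cong[where f = Sup]) auto

lemma linear_proj_perp:
  fixes V :: "'a::euclidean_space set"
  assumes V: "subspace V"
  shows "linear (proj_perp V)"
proof (rule linearI)
  note S = subspace_orthogonal_comp[of V]
  show "proj_perp V (x + y) = proj_perp V x + proj_perp V y" for x y
  proof (rule proj_perp_unique[OF V])
    show "proj_perp V x + proj_perp V y \<in> V\<^sup>\<bottom>"
      using proj_perp_works[OF V] S by (simp add: subspace_add)
    have "(x - proj_perp V x) + (y - proj_perp V y) \<in> V"
      using proj_perp_works[OF V] V by (simp add: subspace_add)
    then show "x + y - (proj_perp V x + proj_perp V y) \<in> V" by (simp add: algebra_simps)
  qed
  show "proj_perp V (r *\<^sub>R x) = r *\<^sub>R proj_perp V x" for r x
  proof (rule proj_perp_unique[OF V])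
    show "r *\<^sub>R proj_perp V x \<in> V\<^sup>\<bottom>"
      using proj_perp_works[OF V] S by (simp add: subspace_scale)
    have "r *\<^sub>R (x - proj_perp V x) \<in> V"
      using proj_perp_works[OF V] V by (simp add: subspace_scale)
    then show "r *\<^sub>R x - r *\<^sub>R proj_perp V x \<in> V" by (simp add: algebra_simps)
  qed
qed

lemma proj_perp_inner:
  fixes V :: "'a::euclidean_space set"
  assumes V: "subspace V"
  shows "proj_perp V x \<bullet> y = proj_perp V x \<bullet> proj_perp V y"
proof -
  have "orthogonal (y - proj_perp V y) (proj_perp V x)"
    using proj_perp_works[OF V] by (auto simp: orthogonal_comp_def)
  then show ?thesis by (simp add: orthogonal_def inner_diff_left inner_diff_right inner_commute)
qed

lemma feasible_quadratic:
  fixes V :: "'a::euclidean_space set" and \<Lambda> :: "'a \<Rightarrow> real ^ 'm"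
  assumes V: "subspace V" and L: "linear \<Lambda>" and "feasible V \<Lambda> (c, d)"
  shows "(norm h)\<^sup>2 \<le> c * (norm (proj_perp V h))\<^sup>2 + d * (norm (\<Lambda> h))\<^sup>2"
proof -
  have "0 \<le> (c *\<^sub>R proj_perp V h + d *\<^sub>R adjoint \<Lambda> (\<Lambda> h) - h) \<bullet> h"
    using assms(3) by (auto simp: feasible_def loewner_ge_def pos_semidef_def)
  then show ?thesis
    by (simp add: inner_diff_left inner_add_left adjoint_clauses[OF L]
        proj_perp_inner[OF V, of h h] power2_norm_eq_inner)
qed

(* The argmin defining reg_map exists and is unique at the parameter given by any feasible pair. *)
lemma reg_objective_unique_minimizer:
  fixes V :: "'a::euclidean_space set" and \<Lambda> :: "'a \<Rightarrow> real ^ 'm"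
  assumes V: "subspace V" and L: "linear \<Lambda>" and F: "feasible V \<Lambda> (c, d)"
  shows "\<exists>!f. is_arg_min (reg_objective V \<Lambda> (d / (c + d)) y) (\<lambda>_. True) f"
proof -
  define t where "t = d / (c + d)"
  define P where "P = proj_perp V"
  define B where "B f = (1 - t) *\<^sub>R P f + t *\<^sub>R adjoint \<Lambda> (\<Lambda> f)" for f
  define J where "J = reg_objective V \<Lambda> t y"
  have cd: "0 \<le> c" "0 \<le> d" using F by (auto simp: feasible_def)
  have q: "(norm h)\<^sup>2 \<le> c * (norm (P h))\<^sup>2 + d * (norm (\<Lambda> h))\<^sup>2" for h
    using feasible_quadratic[OF V L F] by (simp add: P_def)
  obtain b :: 'a where "b \<in> Basis" using nonempty_Basis by blast
  then have "0 < c + d" using q[of b] cd by (cases "c = 0 \<and> d = 0") auto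
  then have t: "(c + d) * (1 - t) = c" "(c + d) * t = d"
    by (auto simp: t_def field_simps)
  have linP: "linear P" using linear_proj_perp[OF V] by (simp add: P_def)
  have linB: "linear B"
    unfolding B_def by (intro linear_compose_add linear_compose_scale_right linP
        linear_compose[OF L adjoint_linear[OF L], unfolded o_def])
  have Bhh: "B h \<bullet> h = (1 - t) * (norm (P h))\<^sup>2 + t * (norm (\<Lambda> h))\<^sup>2" for h
    by (simp add: B_def P_def inner_add_left adjoint_clauses[OF L]
        proj_perp_inner[OF V, of h h] power2_norm_eq_inner)
  have pos: "0 < B h \<bullet> h" if "h \<noteq> 0" for h
  proof -
    have "(c + d) * (B h \<bullet> h) = c * (norm (P h))\<^sup>2 + d * (norm (\<Lambda> h))\<^sup>2"
      unfolding Bhh distrib_left mult.assoc[symmetric] t ..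
    moreover have "0 < (norm h)\<^sup>2" using that by simp
    ultimately have "0 < (c + d) * (B h \<bullet> h)" using q[of h] by linarith
    then show ?thesis using \<open>0 < c + d\<close> by (simp add: zero_less_mult_iff)
  qed
  have "inj B"
    unfolding linear_injective_0[OF linB] using pos by (metis inner_zero_left less_irrefl)
  then have "surj B" using linear_injective_imp_surjective[OF linB] by simp
  then obtain f0 where f0: "B f0 = t *\<^sub>R adjoint \<Lambda> y" by (metis surjD)
  have J: "J (f0 + h) = J f0 + B h \<bullet> h" for h
  proof -
    have "B f0 \<bullet> h = (t *\<^sub>R adjoint \<Lambda> y) \<bullet> h" by (simp add: f0)
    then have cross: "(1 - t) * (P f0 \<bullet> P h) + t * (\<Lambda> f0 \<bullet> \<Lambda> h) = t * (y \<bullet> \<Lambda> h)"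
      by (simp add: B_def P_def inner_add_left adjoint_clauses[OF L] proj_perp_inner[OF V, of f0 h])
    have 1: "(norm (P (f0 + h)))\<^sup>2 = (norm (P f0))\<^sup>2 + 2 * (P f0 \<bullet> P h) + (norm (P h))\<^sup>2"
      by (simp add: linear_add[OF linP] power2_norm_eq_inner algebra_simps inner_commute)
    have 2: "(norm (\<Lambda> (f0 + h) - y))\<^sup>2 =
        (norm (\<Lambda> f0 - y))\<^sup>2 + 2 * (\<Lambda> f0 \<bullet> \<Lambda> h) - 2 * (y \<bullet> \<Lambda> h) + (norm (\<Lambda> h))\<^sup>2"
      by (simp add: linear_add[OF L] power2_norm_eq_inner algebra_simps inner_commute)
    show ?thesis
      using cross unfolding J_def reg_objective_def P_def[symmetric] 1 2 Bhh
      by (simp add: algebra_simps)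
  qed
  have Jf: "J f0 < J f" if "f \<noteq> f0" for f
    using J[of "f - f0"] pos[of "f - f0"] that by simp
  have "\<exists>!f. is_arg_min J (\<lambda>_. True) f"
  proof (rule ex1I[of _ f0])
    show "is_arg_min J (\<lambda>_. True) f0"
      unfolding is_arg_min_def using Jf by (metis less_asym less_irrefl)
    show "f = f0" if "is_arg_min J (\<lambda>_. True) f" for f
      using that Jf[of f] by (auto simp: is_arg_min_def)
  qed
  then show ?thesis by (simp add: J_def t_def)
qed

end

theory Submission
  imports Defs
begin

text \<open>
  Write \<open>P\<close> for the projector onto the orthogonal complement of \<open>V\<close> and \<open>p\<close> for the optimal value
  \<open>c \<epsilon>\<^sup>2 + d \<eta>\<^sup>2\<close>. Both sides of the equation are equal to the square root of \<open>p\<close>.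

  Upper bound (\<open>reg_map_error_bound\<close>). Up to the positive factor \<open>c + d\<close>, the regularization objective is
  \<open>c \<parallel>P f\<parallel>\<^sup>2 + d \<parallel>\<Lambda> f - y\<parallel>\<^sup>2\<close>. A quadratic function exceeds its minimum by its leading part, evaluated at
  the displacement \<open>h\<close> from the minimizer, and here feasibility of \<open>(c, d)\<close> says that this leading part is
  at least \<open>\<parallel>h\<parallel>\<^sup>2\<close>. With \<open>y = \<Lambda> f + e\<close> the objective at the true \<open>f\<close> is at most \<open>p\<close>, so the squared
  recovery error is at most \<open>p\<close>.

  Lower bound (\<open>gwce_lower_bound\<close>). If \<open>\<parallel>P h\<parallel> \<le> \<epsilon>\<close> and \<open>\<parallel>\<Lambda> h\<parallel> \<le> \<eta>\<close>, then both \<open>h\<close> and \<open>-h\<close> can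
  produce the observation \<open>0\<close>, so no recovery map has a worst-case error below \<open>\<parallel>h\<parallel>\<close>.

  The two bounds meet because the semidefinite program is an exact dual of the maximization of
  \<open>\<parallel>h\<parallel>\<^sup>2\<close> under these two constraints (\<open>two_ellipsoid_duality\<close>). The relaxation is tight since there are
  only two constraints: on the null space of the slack form
  \<open>c \<parallel>P x\<parallel>\<^sup>2 + d \<parallel>\<Lambda> x\<parallel>\<^sup>2 - \<parallel>x\<parallel>\<^sup>2\<close> the constraint values \<open>(\<parallel>P x\<parallel>\<^sup>2, \<parallel>\<Lambda> x\<parallel>\<^sup>2)\<close> of unit vectors
  fill a connected part of a line, and optimality of \<open>(c, d)\<close> prevents this part from lying strictly on one
  side of the direction \<open>(\<epsilon>\<^sup>2, \<eta>\<^sup>2)\<close>.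
\<close>

section \<open>Positive semidefinite forms and their null cones\<close>

lemma norm_sq_parallelogram:
  fixes u v :: "'a::real_inner"
  shows "(norm (u + v))\<^sup>2 + (norm (u - v))\<^sup>2 = 2 * (norm u)\<^sup>2 + 2 * (norm v)\<^sup>2"
  by (simp add: power2_norm_eq_inner inner_add_left inner_add_right inner_diff_left inner_diff_right)

text \<open>
  Moving a semidefinite form \<open>M\<close> a little in a direction \<open>Q\<close> that is positive on the null cone of \<open>M\<close> makes
  it definite, by compactness of the unit sphere: where \<open>Q \<le> 0\<close> the form \<open>M\<close> is bounded away from \<open>0\<close> and
  absorbs a small multiple of \<open>Q\<close>, and elsewhere \<open>Q\<close> itself helps.
\<close>
lemma coercive_perturbation:
  fixes M Q :: "'a::euclidean_space \<Rightarrow> real"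
  assumes contM: "continuous_on UNIV M" and contQ: "continuous_on UNIV Q"
    and M0: "\<And>x. 0 \<le> M x"
    and Qpos: "\<And>x. x \<noteq> 0 \<Longrightarrow> M x = 0 \<Longrightarrow> 0 < Q x"
    and homM: "\<And>s x. M (s *\<^sub>R x) = s\<^sup>2 * M x" and homQ: "\<And>s x. Q (s *\<^sub>R x) = s\<^sup>2 * Q x"
    and T: "0 < T"
  shows "\<exists>t \<mu>. 0 < t \<and> t \<le> T \<and> 0 < \<mu> \<and> (\<forall>x. \<mu> * (norm x)\<^sup>2 \<le> M x + t * Q x)"
proof -
  define S :: "'a set" where "S = sphere 0 1"
  have S: "compact S" "S \<noteq> {}" by (auto simp: S_def)
  define K where "K = S \<inter> {x. Q x \<le> 0}"
  have "closed {x. Q x \<le> 0}"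
    using contQ by (intro closed_Collect_le) auto
  then have K: "compact K" unfolding K_def using S by (simp add: compact_Int_closed)
  have MK: "0 < M x" if "x \<in> K" for x
    using that M0[of x] Qpos[of x] by (force simp: K_def S_def)
  obtain m where m: "0 < m" "\<And>x. x \<in> K \<Longrightarrow> m \<le> M x"
  proof (cases "K = {}")
    case True then show thesis using that[of 1] by auto
  next
    case False
    obtain z where "z \<in> K" "\<forall>x\<in>K. M z \<le> M x"
      using continuous_attains_inf[OF K False continuous_on_subset[OF contM subset_UNIV]] by blast
    then show thesis using that MK by blast
  qed
  obtain w where w: "w \<in> S" "\<And>x. x \<in> S \<Longrightarrow> Q w \<le> Q x"
    using continuous_attains_inf[OF S continuous_on_subset[OF contQ subset_UNIV]] by blast
  define t where "t = min T (m / (\<bar>Q w\<bar> + 1))"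
  have t: "0 < t" "t \<le> T" using T m(1) by (auto simp: t_def)
  have tQ: "t * \<bar>Q w\<bar> < m"
  proof -
    have "t * (\<bar>Q w\<bar> + 1) \<le> m"
      using min.cobounded2[of T "m / (\<bar>Q w\<bar> + 1)"] unfolding t_def[symmetric]
      by (simp add: pos_le_divide_eq)
    then show ?thesis using t(1) by (simp add: algebra_simps)
  qed
  have pos: "0 < M x + t * Q x" if x: "x \<in> S" for x
  proof (cases "x \<in> K")
    case True
    have "- \<bar>Q w\<bar> \<le> Q x" using w(2)[OF x] by linarith
    then have "t * - \<bar>Q w\<bar> \<le> t * Q x" using t(1) by (intro mult_left_mono) auto
    then show ?thesis using m(2)[OF True] tQ by simp
  next
    case False
    then have "0 < Q x" using x by (auto simp: K_def)
    then show ?thesis using M0[of x] t(1) by (simp add: add_nonneg_pos)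
  qed
  have "continuous_on S (\<lambda>x. M x + t * Q x)"
    by (intro continuous_intros continuous_on_subset[OF contM] continuous_on_subset[OF contQ]) auto
  from continuous_attains_inf[OF S this] obtain z where z: "z \<in> S"
    "\<And>x. x \<in> S \<Longrightarrow> M z + t * Q z \<le> M x + t * Q x" by blast
  define \<mu> where "\<mu> = M z + t * Q z"
  have "\<mu> * (norm x)\<^sup>2 \<le> M x + t * Q x" for x
  proof (cases "x = 0")
    case True
    then show ?thesis using homM[of 0 x] homQ[of 0 x] by simp
  next
    case False
    define u where "u = (1 / norm x) *\<^sub>R x"
    have x: "x = norm x *\<^sub>R u" and u: "u \<in> S" using False by (auto simp: u_def S_def)
    have "M x + t * Q x = (norm x)\<^sup>2 * (M u + t * Q u)"
      using homM[of "norm x" u] homQ[of "norm x" u] x by (simp add: algebra_simps)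
    moreover have "\<mu> \<le> M u + t * Q u" using z(2)[OF u] by (simp add: \<mu>_def)
    ultimately show ?thesis using mult_right_mono[of \<mu> "M u + t * Q u" "(norm x)\<^sup>2"]
      by (simp add: mult.commute)
  qed
  then show ?thesis using t pos[OF z(1)] \<mu>_def by blast
qed

text \<open>
  The parallelogram law makes the null cone of a nonnegative form \<open>M\<close> a linear subspace, so it contains the
  segment from \<open>u\<close> to \<open>v\<close>, on which \<open>g\<close> changes sign. The segment avoids \<open>0\<close>, since
  otherwise \<open>u\<close> and \<open>v\<close> would be collinear and \<open>g\<close>, being homogeneous of even degree, could not have
  strictly opposite signs at them.
\<close>
lemma sign_change_on_null_cone:
  fixes M g :: "'a::real_normed_vector \<Rightarrow> real"
  assumes M0: "\<And>x. 0 \<le> M x"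
    and parM: "\<And>u v. M (u + v) + M (u - v) = 2 * M u + 2 * M v"
    and homM: "\<And>s x. M (s *\<^sub>R x) = s\<^sup>2 * M x" and homg: "\<And>s x. g (s *\<^sub>R x) = s\<^sup>2 * g x"
    and contg: "continuous_on UNIV g"
    and u: "u \<noteq> 0" "M u = 0" "g u \<le> 0" and v: "v \<noteq> 0" "M v = 0" "0 \<le> g v"
  shows "\<exists>h. h \<noteq> 0 \<and> M h = 0 \<and> g h = 0"
proof (cases "g u = 0 \<or> g v = 0")
  case True then show ?thesis using u v by blast
next
  case False
  then have lt: "g u < 0" "0 < g v" using u(3) v(3) by auto
  define \<gamma> where "\<gamma> s = (1 - s) *\<^sub>R u + s *\<^sub>R v" for s :: real
  have "continuous_on {0..1} (\<lambda>s. g (\<gamma> s))"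
    unfolding \<gamma>_def
    by (intro continuous_on_compose2[OF contg] continuous_intros) auto
  then obtain s where s: "0 \<le> s" "s \<le> 1" "g (\<gamma> s) = 0"
    using IVT'[of "\<lambda>s. g (\<gamma> s)" 0 0 1] lt by (auto simp: \<gamma>_def)
  have "M (\<gamma> s) + M ((1 - s) *\<^sub>R u - s *\<^sub>R v) = 0"
    unfolding \<gamma>_def parM homM using u(2) v(2) by simp
  then have "M (\<gamma> s) = 0"
    using M0[of "\<gamma> s"] M0[of "(1 - s) *\<^sub>R u - s *\<^sub>R v"] by linarith
  moreover have "\<gamma> s \<noteq> 0"
  proof
    assume "\<gamma> s = 0"
    then have "s *\<^sub>R v = (s - 1) *\<^sub>R u"
      by (simp add: \<gamma>_def algebra_simps add_eq_0_iff)
    then have eq: "s\<^sup>2 * g v = (s - 1)\<^sup>2 * g u" using homg by metis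
    have "0 \<le> s\<^sup>2 * g v" "(s - 1)\<^sup>2 * g u \<le> 0"
      using lt by (auto simp: mult_nonneg_nonpos)
    then have "s\<^sup>2 * g v = 0" "(s - 1)\<^sup>2 * g u = 0" using eq by linarith+
    then show False using lt by auto
  qed
  ultimately show ?thesis using s(3) by blast
qed

section \<open>Strong duality for two quadratic constraints\<close>

text \<open>
  Weak duality is immediate: \<open>\<parallel>h\<parallel>\<^sup>2 \<le> c \<parallel>A h\<parallel>\<^sup>2 + d \<parallel>B h\<parallel>\<^sup>2 \<le> c \<epsilon>\<^sup>2 + d \<eta>\<^sup>2\<close>. Equality requires an \<open>h\<close>
  in the null space of the slack form \<open>M\<close> with complementary slackness: the first constraint is tight if
  \<open>c > 0\<close>, the second if \<open>d > 0\<close>. Up to scaling \<open>h\<close>, this is a sign condition on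
  \<open>g h = \<eta>\<^sup>2 \<parallel>A h\<parallel>\<^sup>2 - \<epsilon>\<^sup>2 \<parallel>B h\<parallel>\<^sup>2\<close>. If \<open>g\<close> had the wrong sign on the whole null space, then trading \<open>c\<close>
  against \<open>d\<close> along \<open>(\<eta>\<^sup>2, -\<epsilon>\<^sup>2)\<close>, which keeps the objective constant, would make \<open>M\<close> definite, and
  both multipliers could then be decreased.
\<close>
lemma two_ellipsoid_duality:
  fixes A :: "'a::euclidean_space \<Rightarrow> 'b::real_inner" and B :: "'a \<Rightarrow> 'c::real_inner"
  assumes A: "linear A" and B: "linear B"
    and \<epsilon>: "0 < \<epsilon>" and \<eta>: "0 \<le> \<eta>" and cd: "0 \<le> c" "0 \<le> d"
    and feas: "\<And>x. (norm x)\<^sup>2 \<le> c * (norm (A x))\<^sup>2 + d * (norm (B x))\<^sup>2"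
    and opt: "\<And>c' d'. 0 \<le> c' \<Longrightarrow> 0 \<le> d' \<Longrightarrow>
        (\<And>x. (norm x)\<^sup>2 \<le> c' * (norm (A x))\<^sup>2 + d' * (norm (B x))\<^sup>2) \<Longrightarrow>
        c * \<epsilon>\<^sup>2 + d * \<eta>\<^sup>2 \<le> c' * \<epsilon>\<^sup>2 + d' * \<eta>\<^sup>2"
  shows "\<exists>h. norm (A h) \<le> \<epsilon> \<and> norm (B h) \<le> \<eta> \<and> c * \<epsilon>\<^sup>2 + d * \<eta>\<^sup>2 \<le> (norm h)\<^sup>2"
proof (cases "c * \<epsilon>\<^sup>2 + d * \<eta>\<^sup>2 = 0")
  case True
  then show ?thesis
    using \<epsilon> \<eta> linear_0[OF A] linear_0[OF B] by (intro exI[of _ 0]) auto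
next
  case False
  define p where "p = c * \<epsilon>\<^sup>2 + d * \<eta>\<^sup>2"
  have p: "0 < p" using False cd by (simp add: p_def less_le)
  define a where "a x = (norm (A x))\<^sup>2" for x
  define b where "b x = (norm (B x))\<^sup>2" for x
  define M where "M x = c * a x + d * b x - (norm x)\<^sup>2" for x
  define g where "g x = \<eta>\<^sup>2 * a x - \<epsilon>\<^sup>2 * b x" for x
  have ab0: "0 \<le> a x" "0 \<le> b x" for x by (auto simp: a_def b_def)
  have hom: "a (s *\<^sub>R x) = s\<^sup>2 * a x" "b (s *\<^sub>R x) = s\<^sup>2 * b x" for s x
    by (simp_all add: a_def b_def linear_scale[OF A] linear_scale[OF B] power_mult_distrib)
  have homM: "M (s *\<^sub>R x) = s\<^sup>2 * M x" and homg: "g (s *\<^sub>R x) = s\<^sup>2 * g x" for s x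
    by (simp_all add: M_def g_def hom power_mult_distrib algebra_simps)
  have par: "a (u + v) + a (u - v) = 2 * a u + 2 * a v" "b (u + v) + b (u - v) = 2 * b u + 2 * b v"
    for u v
    unfolding a_def b_def linear_add[OF A] linear_add[OF B] linear_diff[OF A] linear_diff[OF B]
    by (rule norm_sq_parallelogram)+
  have parM: "M (u + v) + M (u - v) = 2 * M u + 2 * M v" for u v
  proof -
    have "M (u + v) + M (u - v) = c * (a (u + v) + a (u - v)) + d * (b (u + v) + b (u - v))
        - ((norm (u + v))\<^sup>2 + (norm (u - v))\<^sup>2)"
      by (simp add: M_def algebra_simps)
    then show ?thesis unfolding par norm_sq_parallelogram by (simp add: M_def algebra_simps)
  qed
  have M0: "0 \<le> M x" for x using feas[of x] by (simp add: M_def a_def b_def)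
  have cont: "continuous_on UNIV a" "continuous_on UNIV b"
    unfolding a_def b_def
    by (intro continuous_intros linear_continuous_on linear_conv_bounded_linear[THEN iffD1] A B)+
  have contM: "continuous_on UNIV M" and contg: "continuous_on UNIV g"
    unfolding M_def g_def by (intro continuous_intros cont)+
  \<comment> \<open>The sign \<open>\<sigma>\<close> is the direction of the trade between \<open>c\<close> and \<open>d\<close>; \<open>T\<close> is how far it can go before a
    multiplier becomes negative.\<close>
  have no_descent: False
    if Qpos: "\<And>x. x \<noteq> 0 \<Longrightarrow> M x = 0 \<Longrightarrow> 0 < \<sigma> * g x" and T: "0 < T"
      and nn: "\<And>t. 0 < t \<Longrightarrow> t \<le> T \<Longrightarrow> 0 \<le> c + t * \<sigma> * \<eta>\<^sup>2 \<and> 0 \<le> d - t * \<sigma> * \<epsilon>\<^sup>2" for \<sigma> T :: real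
  proof -
    have "continuous_on UNIV (\<lambda>x. \<sigma> * g x)" by (intro continuous_intros contg)
    then have "\<exists>t \<mu>. 0 < t \<and> t \<le> T \<and> 0 < \<mu> \<and> (\<forall>x. \<mu> * (norm x)\<^sup>2 \<le> M x + t * (\<sigma> * g x))"
      by (intro coercive_perturbation contM M0 Qpos homM T) (auto simp: homg algebra_simps)
    then obtain t \<mu> where t: "0 < t" "t \<le> T" "0 < \<mu>"
      and co: "\<And>x. \<mu> * (norm x)\<^sup>2 \<le> M x + t * (\<sigma> * g x)" by blast
    \<comment> \<open>The definite form leaves room to divide both multipliers by \<open>1 + \<mu>\<close>.\<close>
    define c' where "c' = (c + t * \<sigma> * \<eta>\<^sup>2) / (1 + \<mu>)"
    define d' where "d' = (d - t * \<sigma> * \<epsilon>\<^sup>2) / (1 + \<mu>)"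
    have c'd': "(1 + \<mu>) * c' = c + t * \<sigma> * \<eta>\<^sup>2" "(1 + \<mu>) * d' = d - t * \<sigma> * \<epsilon>\<^sup>2"
      using t by (auto simp: c'_def d'_def)
    have "(norm x)\<^sup>2 \<le> c' * a x + d' * b x" for x
    proof -
      have "(1 + \<mu>) * (c' * a x + d' * b x) = (c + t * \<sigma> * \<eta>\<^sup>2) * a x + (d - t * \<sigma> * \<epsilon>\<^sup>2) * b x"
        unfolding c'd'[symmetric] by (simp add: algebra_simps)
      also have "\<dots> = M x + t * (\<sigma> * g x) + (norm x)\<^sup>2"
        by (simp add: M_def g_def algebra_simps)
      also have "\<dots> \<ge> (1 + \<mu>) * (norm x)\<^sup>2" using co[of x] by (simp add: algebra_simps)
      finally show ?thesis using t by simp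
    qed
    then have "p \<le> c' * \<epsilon>\<^sup>2 + d' * \<eta>\<^sup>2"
      unfolding p_def using nn[OF t(1,2)] t by (intro opt) (auto simp: c'_def d'_def a_def b_def)
    then have "(1 + \<mu>) * p \<le> (1 + \<mu>) * (c' * \<epsilon>\<^sup>2 + d' * \<eta>\<^sup>2)"
      using t by simp
    also have "\<dots> = (c + t * \<sigma> * \<eta>\<^sup>2) * \<epsilon>\<^sup>2 + (d - t * \<sigma> * \<epsilon>\<^sup>2) * \<eta>\<^sup>2"
      unfolding c'd'[symmetric] by (simp add: algebra_simps)
    also have "\<dots> = p" by (simp add: p_def algebra_simps)
    finally have "\<mu> * p \<le> 0" by (simp add: algebra_simps)
    then show False using mult_pos_pos[OF t(3) p] by linarith
  qed
  have le0: "\<exists>x. x \<noteq> 0 \<and> M x = 0 \<and> g x \<le> 0" if d: "0 < d"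
  proof (rule ccontr)
    assume "\<not> ?thesis"
    then have *: "x \<noteq> 0 \<Longrightarrow> M x = 0 \<Longrightarrow> 0 < 1 * g x" for x by force
    show False
      by (rule no_descent[of 1 "d / \<epsilon>\<^sup>2", OF *]) (use d \<epsilon> cd in \<open>auto simp: field_simps\<close>)
  qed
  have ge0: "\<exists>x. x \<noteq> 0 \<and> M x = 0 \<and> 0 \<le> g x" if c: "0 < c"
  proof (rule ccontr)
    assume "\<not> ?thesis"
    then have *: "x \<noteq> 0 \<Longrightarrow> M x = 0 \<Longrightarrow> 0 < -1 * g x" for x by force
    \<comment> \<open>The denominator \<open>\<eta>\<^sup>2 + 1\<close> keeps the step length positive and finite when \<open>\<eta> = 0\<close>.\<close>
    have "t * \<eta>\<^sup>2 \<le> c" if "0 < t" "t \<le> c / (\<eta>\<^sup>2 + 1)" for t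
    proof -
      have "t * (\<eta>\<^sup>2 + 1) \<le> c" using that by (simp add: pos_le_divide_eq add_nonneg_pos)
      then show ?thesis using that by (simp add: algebra_simps)
    qed
    moreover have "0 < c / (\<eta>\<^sup>2 + 1)" using c by (simp add: add_nonneg_pos)
    ultimately show False
      by (intro no_descent[of "-1" "c / (\<eta>\<^sup>2 + 1)", OF *]) (use cd in auto)
  qed
  have "\<exists>h. h \<noteq> 0 \<and> M h = 0 \<and> (0 < d \<longrightarrow> g h \<le> 0) \<and> (0 < c \<longrightarrow> 0 \<le> g h)"
  proof (cases "0 < c \<and> 0 < d")
    case True
    then obtain u v where "u \<noteq> 0" "M u = 0" "g u \<le> 0" "v \<noteq> 0" "M v = 0" "0 \<le> g v"
      using le0 ge0 by blast
    then have "\<exists>h. h \<noteq> 0 \<and> M h = 0 \<and> g h = 0"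
      by (intro sign_change_on_null_cone[of M g u v] M0 parM homM homg contg)
    then show ?thesis by force
  next
    case False
    have "c \<noteq> 0 \<or> d \<noteq> 0" using p by (auto simp: p_def)
    then show ?thesis using False le0 ge0 cd by force
  qed
  then obtain h where h: "h \<noteq> 0" "M h = 0" "0 < d \<Longrightarrow> g h \<le> 0" "0 < c \<Longrightarrow> 0 \<le> g h" by blast
  have nh: "(norm h)\<^sup>2 = c * a h + d * b h" using h(2) by (simp add: M_def)
  then have pos: "0 < c * a h + d * b h" using h(1) by (metis zero_less_norm_iff zero_less_power)
  \<comment> \<open>The scaling that takes \<open>\<parallel>h\<parallel>\<^sup>2\<close> to the optimal value \<open>p\<close> brings \<open>h\<close> into both ellipsoids.\<close>
  have prop_bounds: "p * a h \<le> \<epsilon>\<^sup>2 * (norm h)\<^sup>2" "p * b h \<le> \<eta>\<^sup>2 * (norm h)\<^sup>2"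
  proof -
    have "0 \<le> c * g h" "d * g h \<le> 0"
      using h(3,4) cd by (cases "c = 0"; cases "d = 0"; auto simp: mult_nonneg_nonpos)+
    then show "p * a h \<le> \<epsilon>\<^sup>2 * (norm h)\<^sup>2" "p * b h \<le> \<eta>\<^sup>2 * (norm h)\<^sup>2"
      unfolding nh p_def g_def by (simp_all add: algebra_simps)
  qed
  define s where "s = sqrt p / norm h"
  have s2: "s\<^sup>2 * (norm h)\<^sup>2 = p" using p h(1) by (simp add: s_def power_divide)
  have "s\<^sup>2 * a h \<le> \<epsilon>\<^sup>2" "s\<^sup>2 * b h \<le> \<eta>\<^sup>2"
    using prop_bounds h(1) p by (simp_all add: s_def power_divide divide_le_eq)
  then have "a (s *\<^sub>R h) \<le> \<epsilon>\<^sup>2" "b (s *\<^sub>R h) \<le> \<eta>\<^sup>2" by (simp_all add: hom)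
  then have "norm (A (s *\<^sub>R h)) \<le> \<epsilon>" "norm (B (s *\<^sub>R h)) \<le> \<eta>"
    using \<epsilon> \<eta> unfolding a_def b_def by (auto intro: power2_le_imp_le)
  moreover have "p \<le> (norm (s *\<^sub>R h))\<^sup>2" using s2 by (simp add: power_mult_distrib)
  ultimately show ?thesis unfolding p_def by blast
qed

section \<open>Bounds on the worst-case error\<close>

lemma feasible_iff_quadratic:
  fixes V :: "'a::euclidean_space set" and \<Lambda> :: "'a \<Rightarrow> real ^ 'm"
  assumes V: "subspace V" and L: "linear \<Lambda>"
  shows "feasible V \<Lambda> (c, d) \<longleftrightarrow> 0 \<le> c \<and> 0 \<le> d \<and>
    (\<forall>h. (norm h)\<^sup>2 \<le> c * (norm (proj_perp V h))\<^sup>2 + d * (norm (\<Lambda> h))\<^sup>2)" (is "_ \<longleftrightarrow> ?R")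
proof
  assume "feasible V \<Lambda> (c, d)"
  then show ?R using feasible_quadratic[OF V L] by (auto simp: feasible_def)
next
  assume R: ?R
  define T where "T h = c *\<^sub>R proj_perp V h + d *\<^sub>R adjoint \<Lambda> (\<Lambda> h) - h" for h
  have lin: "linear T"
    unfolding T_def
    by (intro linear_compose_sub linear_compose_add linear_compose_scale_right linear_proj_perp V
        linear_compose[OF L adjoint_linear[OF L], unfolded o_def] linear_ident)
  have "T x \<bullet> y = x \<bullet> T y" for x y
    using proj_perp_inner[OF V, of x y] proj_perp_inner[OF V, of y x]
    by (simp add: T_def inner_add_left inner_add_right inner_diff_left inner_diff_right
        adjoint_clauses[OF L] inner_commute)
  then have adj: "adjoint T = T" by (intro adjoint_unique) auto
  have "T x \<bullet> x = c * (norm (proj_perp V x))\<^sup>2 + d * (norm (\<Lambda> x))\<^sup>2 - (norm x)\<^sup>2" for x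
    by (simp add: T_def inner_diff_left inner_add_left adjoint_clauses[OF L]
        proj_perp_inner[OF V, of x x] power2_norm_eq_inner)
  then have "pos_semidef T" using lin adj R by (simp add: pos_semidef_def)
  then show "feasible V \<Lambda> (c, d)"
    using R by (simp add: feasible_def loewner_ge_def T_def[abs_def])
qed

lemma nonneg_slope_of_nonneg_quadratic:
  fixes l q :: real
  assumes "\<And>s. 0 < s \<Longrightarrow> 0 \<le> s * l + s\<^sup>2 * q" and q: "0 \<le> q"
  shows "0 \<le> l"
proof (rule ccontr)
  assume "\<not> 0 \<le> l"
  then have l: "l < 0" by simp
  define s where "s = - l / (q + 1)"
  have s: "0 < s" "s * (q + 1) = - l" using l q by (auto simp: s_def divide_neg_pos)
  then have "0 \<le> s * (l + s * q)" using assms(1)[of s] by (simp add: power2_eq_square algebra_simps)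
  then have "0 \<le> l + s * q" using s(1) by (simp add: zero_le_mult_iff)
  then show False using s by (simp add: algebra_simps)
qed

text \<open>
  Along the line from the minimizer \<open>z\<close> towards \<open>f\<close> the objective is \<open>J z + s l + s\<^sup>2 q\<close> with \<open>l \<ge> 0\<close> by
  minimality. At \<open>s = 1\<close> this gives \<open>q \<le> J f\<close>, where \<open>(c + d) q\<close> dominates the squared error by feasibility and
  \<open>(c + d) J f\<close> is the right-hand side.
\<close>
lemma reg_map_error_bound:
  fixes V :: "'a::euclidean_space set" and \<Lambda> :: "'a \<Rightarrow> real ^ 'm"
  assumes V: "subspace V" and L: "linear \<Lambda>" and F: "feasible V \<Lambda> (c, d)"
  shows "(norm (f - reg_map V \<Lambda> (d / (c + d)) (\<Lambda> f + e)))\<^sup>2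
      \<le> c * (norm (proj_perp V f))\<^sup>2 + d * (norm e)\<^sup>2"
proof -
  define t where "t = d / (c + d)"
  define y where "y = \<Lambda> f + e"
  define P where "P = proj_perp V"
  define J where "J = reg_objective V \<Lambda> t y"
  define z where "z = reg_map V \<Lambda> t y"
  define h where "h = f - z"
  define q where "q = (1 - t) * (norm (P h))\<^sup>2 + t * (norm (\<Lambda> h))\<^sup>2"
  define l where "l = 2 * ((1 - t) * (P z \<bullet> P h) + t * ((\<Lambda> z - y) \<bullet> \<Lambda> h))"
  have cd: "0 \<le> c" "0 \<le> d" using F by (auto simp: feasible_def)
  have feas: "(norm x)\<^sup>2 \<le> c * (norm (P x))\<^sup>2 + d * (norm (\<Lambda> x))\<^sup>2" for x
    using feasible_quadratic[OF V L F] by (simp add: P_def)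
  \<comment> \<open>The multipliers cannot both vanish, because the space contains a nonzero vector.\<close>
  obtain b :: 'a where "b \<in> Basis" using nonempty_Basis by blast
  then have cd0: "0 < c + d" using feas[of b] cd by (cases "c = 0 \<and> d = 0") auto
  then have t: "(c + d) * (1 - t) = c" "(c + d) * t = d"
    by (auto simp: t_def field_simps)
  have scale: "(c + d) * ((1 - t) * u + t * v) = c * u + d * v" for u v
    unfolding distrib_left mult.assoc[symmetric] t ..
  have t01: "0 \<le> t" "0 \<le> 1 - t" using cd cd0 by (auto simp: t_def field_simps)
  have linP: "linear P" using linear_proj_perp[OF V] by (simp add: P_def)
  have "is_arg_min J (\<lambda>_. True) z"
    using someI_ex[OF ex1_implies_ex[OF reg_objective_unique_minimizer[OF V L F, of y]]]
    by (simp add: z_def reg_map_def arg_min_def J_def t_def)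
  then have min: "J z \<le> J x" for x by (auto simp: is_arg_min_def not_less)
  have J: "J (z + s *\<^sub>R h) = J z + (s * l + s\<^sup>2 * q)" for s
  proof -
    have 1: "(norm (P (z + s *\<^sub>R h)))\<^sup>2 = (norm (P z))\<^sup>2 + 2 * s * (P z \<bullet> P h) + s\<^sup>2 * (norm (P h))\<^sup>2"
      unfolding linear_add[OF linP] linear_scale[OF linP] power2_norm_eq_inner
      by (simp add: inner_add_left inner_add_right inner_commute power2_eq_square)
    have "\<Lambda> (z + s *\<^sub>R h) - y = (\<Lambda> z - y) + s *\<^sub>R \<Lambda> h"
      by (simp add: linear_add[OF L] linear_scale[OF L])
    then have 2: "(norm (\<Lambda> (z + s *\<^sub>R h) - y))\<^sup>2 =
        (norm (\<Lambda> z - y))\<^sup>2 + 2 * s * ((\<Lambda> z - y) \<bullet> \<Lambda> h) + s\<^sup>2 * (norm (\<Lambda> h))\<^sup>2"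
      by (simp only: power2_norm_eq_inner)
        (simp add: inner_add_left inner_add_right inner_commute power2_eq_square)
    show ?thesis
      unfolding J_def reg_objective_def P_def[symmetric] 1 2 l_def q_def by (simp add: algebra_simps)
  qed
  have "0 \<le> l"
  proof (rule nonneg_slope_of_nonneg_quadratic)
    show "0 \<le> s * l + s\<^sup>2 * q" for s using min[of "z + s *\<^sub>R h"] J[of s] by simp
    show "0 \<le> q" using t01 by (simp add: q_def)
  qed
  moreover have "0 \<le> J z" using t01 by (simp add: J_def reg_objective_def)
  ultimately have "q \<le> J f" using J[of 1] by (simp add: h_def)
  then have "(c + d) * q \<le> (c + d) * J f" using cd0 by simp
  moreover have "(c + d) * q \<ge> (norm h)\<^sup>2"
    unfolding q_def scale by (rule feas)
  moreover have "(c + d) * J f = c * (norm (P f))\<^sup>2 + d * (norm e)\<^sup>2"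
    unfolding J_def reg_objective_def P_def[symmetric] scale by (simp add: y_def)
  ultimately show ?thesis by (simp add: h_def z_def y_def t_def P_def)
qed

text \<open>
  The signals \<open>h\<close> and \<open>-h\<close> are indistinguishable: with noise \<open>-\<Lambda> h\<close> and \<open>\<Lambda> h\<close>, both are observed as \<open>0\<close>.
  Any guess \<open>\<Delta> 0\<close> is at distance at least \<open>\<parallel>h\<parallel>\<close> from one of them.
\<close>
lemma gwce_lower_bound:
  fixes V :: "'a::euclidean_space set" and \<Lambda> :: "'a \<Rightarrow> real ^ 'm"
  assumes V: "subspace V" and L: "linear \<Lambda>"
    and h: "norm (proj_perp V h) \<le> \<epsilon>" "norm (\<Lambda> h) \<le> \<eta>"
  shows "ereal (norm h) \<le> gwce \<Lambda> (approximability_set V \<epsilon>) (uncertainty_set \<eta>) \<Delta>"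
proof -
  have err: "ereal (norm (x - \<Delta> 0)) \<le> gwce \<Lambda> (approximability_set V \<epsilon>) (uncertainty_set \<eta>) \<Delta>"
    if "norm (proj_perp V x) \<le> \<epsilon>" "norm (\<Lambda> x) \<le> \<eta>" for x
    unfolding gwce_eq[OF V] using that by (intro Sup_upper CollectI exI[of _ x] exI[of _ "- \<Lambda> x"]) auto
  have "norm h \<le> max (norm (h - \<Delta> 0)) (norm (- h - \<Delta> 0))"
  proof -
    have "2 * norm h = norm ((h - \<Delta> 0) - (- h - \<Delta> 0))"
      by (simp add: scaleR_2[symmetric])
    also have "\<dots> \<le> norm (h - \<Delta> 0) + norm (- h - \<Delta> 0)" by (rule norm_triangle_ineq4)
    finally show ?thesis by simp
  qed
  moreover have "ereal (max (norm (h - \<Delta> 0)) (norm (- h - \<Delta> 0)))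
      \<le> gwce \<Lambda> (approximability_set V \<epsilon>) (uncertainty_set \<eta>) \<Delta>"
    using err[OF h] err[of "- h"] h linear_neg[OF linear_proj_perp[OF V]] linear_neg[OF L]
    by (simp add: max_def)
  ultimately show ?thesis by (meson ereal_less_eq(3) order_trans)
qed

section \<open>Optimality of the regularization map\<close>

theorem theorem10:
  fixes V :: "'a::euclidean_space set"
    and \<Lambda> :: "'a \<Rightarrow> real ^ 'm"
    and \<epsilon> \<eta> c d :: real
  assumes "subspace V"
    and "linear \<Lambda>"
    and "V \<inter> {f. \<Lambda> f = 0} = {0}"
    and "\<epsilon> > 0"
    and "\<eta> \<ge> 0"
    and "is_arg_min (\<lambda>(c, d). c * \<epsilon>\<^sup>2 + d * \<eta>\<^sup>2) (feasible V \<Lambda>) (c, d)"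
  shows "gwce \<Lambda> (approximability_set V \<epsilon>) (uncertainty_set \<eta>) (reg_map V \<Lambda> (d / (c + d))) =
    (INF \<Delta> :: real ^ 'm \<Rightarrow> 'a. gwce \<Lambda> (approximability_set V \<epsilon>) (uncertainty_set \<eta>) \<Delta>)"
proof (rule antisym[OF _ INF_lower[OF UNIV_I]], rule INF_greatest)
  fix \<Delta> :: "real ^ 'm \<Rightarrow> 'a"
  note V = assms(1) and L = assms(2)
  have F: "feasible V \<Lambda> (c, d)" using assms(6) by (simp add: is_arg_min_def)
  have opt: "c * \<epsilon>\<^sup>2 + d * \<eta>\<^sup>2 \<le> c' * \<epsilon>\<^sup>2 + d' * \<eta>\<^sup>2" if "feasible V \<Lambda> (c', d')" for c' d'
    using assms(6) that by (force simp: is_arg_min_def not_less)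
  have cd: "0 \<le> c" "0 \<le> d" using F by (auto simp: feasible_def)
  obtain h where h: "norm (proj_perp V h) \<le> \<epsilon>" "norm (\<Lambda> h) \<le> \<eta>"
    "c * \<epsilon>\<^sup>2 + d * \<eta>\<^sup>2 \<le> (norm h)\<^sup>2"
    using two_ellipsoid_duality[OF linear_proj_perp[OF V] L assms(4,5) cd feasible_quadratic[OF V L F]]
      opt feasible_iff_quadratic[OF V L] by blast
  have "norm (f - reg_map V \<Lambda> (d / (c + d)) (\<Lambda> f + e)) \<le> norm h"
    if f: "norm (proj_perp V f) \<le> \<epsilon>" and e: "norm e \<le> \<eta>" for f e
  proof (rule power2_le_imp_le)
    have "(norm (f - reg_map V \<Lambda> (d / (c + d)) (\<Lambda> f + e)))\<^sup>2
        \<le> c * (norm (proj_perp V f))\<^sup>2 + d * (norm e)\<^sup>2"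
      by (rule reg_map_error_bound[OF V L F])
    also have "\<dots> \<le> c * \<epsilon>\<^sup>2 + d * \<eta>\<^sup>2"
      using f e cd by (intro add_mono mult_left_mono power_mono) auto
    also have "\<dots> \<le> (norm h)\<^sup>2" by (rule h(3))
    finally show "(norm (f - reg_map V \<Lambda> (d / (c + d)) (\<Lambda> f + e)))\<^sup>2 \<le> (norm h)\<^sup>2" .
  qed simp
  then have "gwce \<Lambda> (approximability_set V \<epsilon>) (uncertainty_set \<eta>) (reg_map V \<Lambda> (d / (c + d))) \<le> ereal (norm h)"
    unfolding gwce_eq[OF V] by (intro Sup_least) auto
  also have "\<dots> \<le> gwce \<Lambda> (approximability_set V \<epsilon>) (uncertainty_set \<eta>) \<Delta>"
    by (rule gwce_lower_bound[OF V L h(1,2)])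
  finally show "gwce \<Lambda> (approximability_set V \<epsilon>) (uncertainty_set \<eta>) (reg_map V \<Lambda> (d / (c + d)))
      \<le> gwce \<Lambda> (approximability_set V \<epsilon>) (uncertainty_set \<eta>) \<Delta>" .
qed

end
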